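(* Let $\alpha=(\alpha_n)_{n\in\mathbb{N}}$ be a non-negative increasing sequence with $\lim_{n\to\infty}\alpha_n=\infty$ and let $\theta\in\Lambda_1(\alpha)$. The convolution operator $\widehat{T}_\theta:\Lambda_1(\alpha)\to\Lambda_1(\alpha)$ is power bounded if and only if $\sup_{k\in\mathbb{N}}\|\theta^{*k}\|_p<\infty$ for every $p\in\mathbb{N}$.
   Context: $\mathbb{N}=\{1,2,\dots\}$, $\mathbb{N}_0=\mathbb{N}\cup\{0\}$. The power series space of finite type is $\Lambda_1(\alpha)=\{x=(x_n)_{n\in\mathbb{N}}:\|x\|_k:=\sum_{n=1}^\infty|x_n|e^{-\frac1k\alpha_n}<\infty\text{ for all }k\in\mathbb{N}\}$, a Fréchet space with the increasing sequence of seminorms $(\|\cdot\|_k)_{k\in\mathbb{N}}$; $(e_n)_{n\in\mathbb{N}}$ is its canonical basis. Symbols are indexed from $0$: $\theta=(\theta_n)_{n\in\mathbb{N}_0}$ is regarded as the element of $\Lambda_1(\alpha)$ whose $n$-th coordinate ($n\in\mathbb{N}$) is $\theta_{n-1}$, so $\|\theta\|_k=\sum_{n=1}^\infty|\theta_{n-1}|e^{-\frac1k\alpha_n}$. The convolution operator $\widehat{T}_\theta$ is the continuous linear operator on $\Lambda_1(\alpha)$ with $\widehat{T}_\theta e_n=\sum_{j=n}^\infty\theta_{j-n}e_j$ and $\widehat{T}_\theta x=\sum_{n=1}^\infty x_n\widehat{T}_\theta e_n$ (it is well-defined and continuous for every $\theta\in\Lambda_1(\alpha)$). Convolution of sequences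 indexed by $\mathbb{N}_0$: $(\theta*\phi)_m=\sum_{i=0}^m\theta_i\phi_{m-i}$; $\theta^{*k}=\theta*\cdots*\theta$ ($k$ factors). A continuous linear operator $T$ on a Fréchet space $E$ with increasing seminorms $(\|\cdot\|_p)_{p\in\mathbb{N}}$ is power bounded if for every $p\in\mathbb{N}$ there exist $q\in\mathbb{N}$ and $C_p\ge1$ with $\|T^kx\|_p\le C_p\|x\|_q$ for all $k\in\mathbb{N}$, $x\in E$. *)

theory Defs
  imports "HOL-Analysis.Analysis"
begin

text \<open>
  All sequences are functions on \<open>nat\<close> and start at index 0: the value at \<open>n\<close> is the coordinate
  (or the exponent \<open>\<alpha>\<close>) written with index \<open>n + 1\<close> when counting from 1. With this convention
  the identification of a symbol \<open>(\<theta>\<^sub>0, \<theta>\<^sub>1, \<dots>)\<close> with the element of the space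
  whose \<open>n\<close>-th coordinate is \<open>\<theta>\<close> at \<open>n - 1\<close> is the identity. Indices of seminorms and
  exponents of iterates range over the positive naturals, as stated explicitly in each quantifier.
  The scalars are an arbitrary complete normed field over the reals, which covers both the
  real and the complex case.
\<close>

definition ps_norm :: "(nat \<Rightarrow> real) \<Rightarrow> nat \<Rightarrow> (nat \<Rightarrow> 'a::real_normed_field) \<Rightarrow> real" where
  "ps_norm \<alpha> k x = (\<Sum>n. norm (x n) * exp (- (1 / real k) * \<alpha> n))"

definition ps_space :: "(nat \<Rightarrow> real) \<Rightarrow> (nat \<Rightarrow> 'a::real_normed_field) set" where
  "ps_space \<alpha> = {x. \<forall>k\<ge>1. summable (\<lambda>n. norm (x n) * exp (- (1 / real k) * \<alpha> n))}"

definition unit_seq :: "nat \<Rightarrow> nat \<Rightarrow> 'a::real_normed_field" where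
  "unit_seq n = (\<lambda>m. if m = n then 1 else 0)"

text \<open>Convergence of a series of elements in the Frechet space, i.e. in every seminorm.\<close>

definition ps_sums ::
  "(nat \<Rightarrow> real) \<Rightarrow> (nat \<Rightarrow> nat \<Rightarrow> 'a::real_normed_field) \<Rightarrow> (nat \<Rightarrow> 'a) \<Rightarrow> bool" where
  "ps_sums \<alpha> f s \<longleftrightarrow>
     (\<forall>n. f n \<in> ps_space \<alpha>) \<and> s \<in> ps_space \<alpha> \<and>
     (\<forall>k\<ge>1. (\<lambda>N. ps_norm \<alpha> k (\<lambda>m. (\<Sum>n<N. f n m) - s m)) \<longlonglongrightarrow> 0)"

definition ps_suminf ::
  "(nat \<Rightarrow> real) \<Rightarrow> (nat \<Rightarrow> nat \<Rightarrow> 'a::real_normed_field) \<Rightarrow> nat \<Rightarrow> 'a" where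
  "ps_suminf \<alpha> f = (THE s. ps_sums \<alpha> f s)"

text \<open>
  The image of the \<open>n\<close>-th basis vector is the sum of \<open>\<theta>\<close> at \<open>j - n\<close> times the \<open>j\<close>-th basis vector
  over \<open>j \<ge> n\<close>, here with \<open>j = n + i\<close>.
\<close>

definition conv_op_unit ::
  "(nat \<Rightarrow> real) \<Rightarrow> (nat \<Rightarrow> 'a::real_normed_field) \<Rightarrow> nat \<Rightarrow> nat \<Rightarrow> 'a" where
  "conv_op_unit \<alpha> \<theta> n = ps_suminf \<alpha> (\<lambda>i m. \<theta> i * unit_seq (n + i) m)"

definition conv_op ::
  "(nat \<Rightarrow> real) \<Rightarrow> (nat \<Rightarrow> 'a::real_normed_field) \<Rightarrow> (nat \<Rightarrow> 'a) \<Rightarrow> nat \<Rightarrow> 'a" where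
  "conv_op \<alpha> \<theta> x = ps_suminf \<alpha> (\<lambda>n m. x n * conv_op_unit \<alpha> \<theta> n m)"

definition conv :: "(nat \<Rightarrow> 'a::real_normed_field) \<Rightarrow> (nat \<Rightarrow> 'a) \<Rightarrow> nat \<Rightarrow> 'a" where
  "conv \<theta> \<phi> m = (\<Sum>i\<le>m. \<theta> i * \<phi> (m - i))"

primrec conv_power :: "(nat \<Rightarrow> 'a::real_normed_field) \<Rightarrow> nat \<Rightarrow> nat \<Rightarrow> 'a" where
  "conv_power \<theta> 0 = unit_seq 0"
| "conv_power \<theta> (Suc k) = conv \<theta> (conv_power \<theta> k)"

text \<open>
  Continuous linear operators on, and power boundedness in, a space \<open>E\<close> of sequences whose topology
  is given by an increasing sequence of seminorms \<open>P 1, P 2, \<dots>\<close>.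
\<close>

definition continuous_linear_operator ::
  "(nat \<Rightarrow> 'a::real_normed_field) set \<Rightarrow> (nat \<Rightarrow> (nat \<Rightarrow> 'a) \<Rightarrow> real) \<Rightarrow>
   ((nat \<Rightarrow> 'a) \<Rightarrow> nat \<Rightarrow> 'a) \<Rightarrow> bool" where
  "continuous_linear_operator E P T \<longleftrightarrow>
     (\<forall>x\<in>E. T x \<in> E) \<and>
     (\<forall>x\<in>E. \<forall>y\<in>E. T (\<lambda>n. x n + y n) = (\<lambda>n. T x n + T y n)) \<and>
     (\<forall>c. \<forall>x\<in>E. T (\<lambda>n. c * x n) = (\<lambda>n. c * T x n)) \<and>
     (\<forall>x\<in>E. \<forall>p\<ge>1. \<forall>\<epsilon>>0. \<exists>q\<ge>1. \<exists>\<delta>>0. \<forall>y\<in>E.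
        P q (\<lambda>n. y n - x n) < \<delta> \<longrightarrow> P p (\<lambda>n. T y n - T x n) < \<epsilon>)"

definition power_bounded ::
  "(nat \<Rightarrow> 'a::real_normed_field) set \<Rightarrow> (nat \<Rightarrow> (nat \<Rightarrow> 'a) \<Rightarrow> real) \<Rightarrow>
   ((nat \<Rightarrow> 'a) \<Rightarrow> nat \<Rightarrow> 'a) \<Rightarrow> bool" where
  "power_bounded E P T \<longleftrightarrow>
     continuous_linear_operator E P T \<and>
     (\<forall>p\<ge>1. \<exists>q\<ge>1. \<exists>C\<ge>1. \<forall>k\<ge>1. \<forall>x\<in>E. P p ((T ^^ k) x) \<le> C * P q x)"

text \<open>
  The remaining facts show that the definite descriptions above are meaningful: both series converge,
  the operator is continuous and linear, and convolution powers stay in the space.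
\<close>

lemma ps_spaceD:
  "x \<in> ps_space \<alpha> \<Longrightarrow> k \<ge> 1 \<Longrightarrow> summable (\<lambda>n. norm (x n) * exp (- (1 / real k) * \<alpha> n))"
  by (auto simp: ps_space_def)

lemma ps_space_add:
  assumes "x \<in> ps_space \<alpha>" "y \<in> ps_space \<alpha>"
  shows "(\<lambda>n. x n + y n) \<in> ps_space \<alpha>"
  unfolding ps_space_def
proof safe
  fix k :: nat assume k: "k \<ge> 1"
  let ?w = "\<lambda>n. exp (- (1 / real k) * \<alpha> n)"
  have "norm (x n + y n) * ?w n \<le> norm (x n) * ?w n + norm (y n) * ?w n" for n
    using mult_right_mono[OF norm_triangle_ineq[of "x n" "y n"], of "?w n"]
    by (simp add: distrib_right)
  then show "summable (\<lambda>n. norm (x n + y n) * ?w n)"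
    by (intro summable_comparison_test[OF _ summable_add[OF assms[THEN ps_spaceD, OF k]]]) auto
qed

lemma ps_space_scale:
  assumes "x \<in> ps_space \<alpha>"
  shows "(\<lambda>n. c * x n) \<in> ps_space \<alpha>"
  using assms by (auto simp: ps_space_def norm_mult mult.assoc intro!: summable_mult)

lemma ps_space_diff:
  assumes "x \<in> ps_space \<alpha>" "y \<in> ps_space \<alpha>"
  shows "(\<lambda>n. x n - y n) \<in> ps_space \<alpha>"
  using ps_space_add[OF assms(1) ps_space_scale[OF assms(2), of "-1"]] by simp

lemma ps_space_sum:
  fixes f :: "nat \<Rightarrow> nat \<Rightarrow> 'a::real_normed_field"
  assumes "\<And>n. f n \<in> ps_space \<alpha>"
  shows "(\<lambda>m. \<Sum>n<N. f n m) \<in> ps_space \<alpha>"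
proof (induction N)
  case 0 show ?case by (simp add: ps_space_def)
next
  case (Suc N) then show ?case using ps_space_add[OF Suc assms[of N]] by simp
qed

lemma ps_space_unit: "unit_seq n \<in> ps_space \<alpha>"
  unfolding ps_space_def
proof safe
  fix k :: nat
  show "summable (\<lambda>m. norm (unit_seq n m :: 'a) * exp (- (1 / real k) * \<alpha> m))"
    by (rule summable_finite[of "{n}"]) (auto simp: unit_seq_def)
qed

lemma ps_norm_nonneg: "x \<in> ps_space \<alpha> \<Longrightarrow> k \<ge> 1 \<Longrightarrow> 0 \<le> ps_norm \<alpha> k x"
  unfolding ps_norm_def by (rule suminf_nonneg[OF ps_spaceD]) auto

lemma ps_sums_coord:
  assumes "ps_sums \<alpha> f s"
  shows "(\<lambda>n. f n m) sums s m"
proof -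
  let ?w = "exp (- (1 / real 1) * \<alpha> m)"
  let ?d = "\<lambda>N m. (\<Sum>n<N. f n m) - s m"
  have d: "?d N \<in> ps_space \<alpha>" for N
    using assms unfolding ps_sums_def by (intro ps_space_diff ps_space_sum) auto
  have "norm (?d N m) * ?w \<le> ps_norm \<alpha> 1 (?d N)" for N
    using sum_le_suminf[OF ps_spaceD[OF d order_refl], of "{m}" N] unfolding ps_norm_def by simp
  then have le: "norm (?d N m) \<le> ps_norm \<alpha> 1 (?d N) / ?w" for N
    by (simp add: pos_le_divide_eq)
  have "(\<lambda>N. ps_norm \<alpha> 1 (?d N) / ?w) \<longlonglongrightarrow> 0 / ?w"
    using assms unfolding ps_sums_def by (intro tendsto_divide tendsto_const) auto
  then have "(\<lambda>N. ps_norm \<alpha> 1 (?d N) / ?w) \<longlonglongrightarrow> 0" by simp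
  then have "(\<lambda>N. ?d N m) \<longlonglongrightarrow> 0"
    by (rule Lim_null_comparison[OF always_eventually, rotated]) (use le in blast)
  then show ?thesis unfolding sums_def by (simp add: LIM_zero_iff)
qed

lemma ps_suminf_eq: "ps_sums \<alpha> f s \<Longrightarrow> ps_suminf \<alpha> f = s"
  unfolding ps_suminf_def by (rule the_equality) (blast intro: sums_unique2 ps_sums_coord)+

lemma ps_trunc:
  assumes x: "x \<in> ps_space \<alpha>" and k: "k \<ge> 1"
  shows "(\<lambda>N. ps_norm \<alpha> k (\<lambda>n. (if n < N then x n else 0) - x n)) \<longlonglongrightarrow> 0"
proof -
  let ?a = "\<lambda>n. norm (x n) * exp (- (1 / real k) * \<alpha> n)"
  have "ps_norm \<alpha> k (\<lambda>n. (if n < N then x n else 0) - x n) = suminf ?a - (\<Sum>n<N. ?a n)" for N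
  proof -
    have "(\<lambda>n. ?a n - (if n \<in> {..<N} then ?a n else 0)) sums (suminf ?a - (\<Sum>n\<in>{..<N}. ?a n))"
      by (intro sums_diff summable_sums[OF ps_spaceD[OF x k]] sums_If_finite_set) auto
    then show ?thesis unfolding ps_norm_def
      by (intro sums_unique[symmetric]) (auto elim!: sums_cong[THEN iffD1, rotated])
  qed
  moreover have "(\<lambda>N. suminf ?a - (\<Sum>n<N. ?a n)) \<longlonglongrightarrow> suminf ?a - suminf ?a"
    by (intro tendsto_diff tendsto_const summable_LIMSEQ ps_spaceD[OF x k])
  ultimately show ?thesis by simp
qed

lemma ps_conv:
  fixes x \<theta> :: "nat \<Rightarrow> 'a::real_normed_field"
  assumes \<alpha>: "mono \<alpha>" and x: "x \<in> ps_space \<alpha>" and \<theta>: "\<theta> \<in> ps_space \<alpha>"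
  shows "conv x \<theta> \<in> ps_space \<alpha>"
    and "k \<ge> 1 \<Longrightarrow> ps_norm \<alpha> k (conv x \<theta>) \<le> ps_norm \<alpha> (2*k) x * ps_norm \<alpha> (2*k) \<theta>"
proof -
  define w where "w k n = exp (- (1 / real k) * \<alpha> n)" for k n
  define c where "c k m = (\<Sum>i\<le>m. (norm (x i) * w (2*k) i) * (norm (\<theta> (m-i)) * w (2*k) (m-i)))"
    for k m
  have le: "norm (conv x \<theta> m) * w k m \<le> c k m" if "k \<ge> 1" for k m
  proof -
    have "norm (conv x \<theta> m) * w k m \<le> (\<Sum>i\<le>m. norm (x i) * norm (\<theta> (m-i))) * w k m"
      unfolding conv_def
      by (intro mult_right_mono order_trans[OF norm_sum] sum_mono) (auto simp: norm_mult w_def)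
    also have "\<dots> \<le> c k m"
      unfolding sum_distrib_right c_def
    proof (rule sum_mono)
      fix i assume i: "i \<in> {..m}"
      have "\<alpha> i \<le> \<alpha> m" "\<alpha> (m - i) \<le> \<alpha> m" using i \<alpha> by (auto simp: mono_def)
      then have "w k m \<le> w (2*k) i * w (2*k) (m-i)"
        unfolding w_def exp_add[symmetric] using that by (simp add: field_simps)
      from mult_left_mono[OF this, of "norm (x i) * norm (\<theta> (m-i))"]
      show "norm (x i) * norm (\<theta> (m-i)) * w k m
          \<le> (norm (x i) * w (2*k) i) * (norm (\<theta> (m-i)) * w (2*k) (m-i))"
        by (simp add: mult_ac)
    qed
    finally show ?thesis .
  qed
  have s: "summable (\<lambda>n. norm (x n) * w (2*k) n)" "summable (\<lambda>n. norm (\<theta> n) * w (2*k) n)"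
    if "k \<ge> 1" for k
    using ps_spaceD[OF x, of "2*k"] ps_spaceD[OF \<theta>, of "2*k"] that by (auto simp: w_def)
  have n: "norm (norm (z::'a) * w k n) = norm z * w k n" for z k n by (simp add: w_def)
  have sc: "summable (c k)" if "k \<ge> 1" for k
    unfolding c_def using s[OF that] by (intro summable_Cauchy_product) (simp_all only: n)
  have sl: "summable (\<lambda>m. norm (conv x \<theta> m) * w k m)" if "k \<ge> 1" for k
    by (rule summable_comparison_test[OF _ sc[OF that]]) (use le[OF that] in \<open>simp only: n, blast\<close>)
  show "conv x \<theta> \<in> ps_space \<alpha>" unfolding ps_space_def using sl by (auto simp: w_def)
  assume k: "k \<ge> 1"
  have "ps_norm \<alpha> k (conv x \<theta>) \<le> suminf (c k)"
    unfolding ps_norm_def using suminf_le[OF le[OF k] sl[OF k] sc[OF k]] by (simp add: w_def)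
  also have "\<dots> = ps_norm \<alpha> (2*k) x * ps_norm \<alpha> (2*k) \<theta>"
    unfolding c_def ps_norm_def w_def[symmetric] using s[OF k]
    by (intro Cauchy_product[symmetric]) (simp_all only: n)
  finally show "ps_norm \<alpha> k (conv x \<theta>) \<le> ps_norm \<alpha> (2*k) x * ps_norm \<alpha> (2*k) \<theta>" .
qed

lemma conv_diff_left: "conv (\<lambda>n. x n - y n) \<theta> = (\<lambda>m. conv x \<theta> m - conv y \<theta> m)"
  by (auto simp: conv_def algebra_simps sum_subtractf)

lemma conv_commute: "conv x y = conv y x"
proof
  fix m
  show "conv x y m = conv y x m" unfolding conv_def
    by (rule sum.reindex_bij_witness[of _ "\<lambda>i. m - i" "\<lambda>i. m - i"]) auto
qed

lemma conv_unit: "conv (unit_seq n) \<theta> m = (if n \<le> m then \<theta> (m - n) else 0)"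
  by (auto simp: conv_def unit_seq_def if_distrib[of "\<lambda>z. z * _"] cong: if_cong)

text \<open>The series of a product with truncations, which covers both series in the definition.\<close>

lemma ps_sums_conv:
  assumes \<alpha>: "mono \<alpha>" and x: "x \<in> ps_space \<alpha>" and \<theta>: "\<theta> \<in> ps_space \<alpha>"
  shows "ps_sums \<alpha> (\<lambda>n m. x n * conv (unit_seq n) \<theta> m) (conv x \<theta>)"
  unfolding ps_sums_def
proof (intro conjI allI impI)
  show "(\<lambda>m. x n * conv (unit_seq n) \<theta> m) \<in> ps_space \<alpha>" for n
    by (intro ps_space_scale ps_conv \<alpha> \<theta> ps_space_unit)
  show "conv x \<theta> \<in> ps_space \<alpha>" by (rule ps_conv[OF assms])
  fix k :: nat assume k: "k \<ge> 1"
  let ?t = "\<lambda>N n. if n < N then x n else 0"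
  have eq: "(\<lambda>m. (\<Sum>n<N. x n * conv (unit_seq n) \<theta> m) - conv x \<theta> m)
      = conv (\<lambda>n. ?t N n - x n) \<theta>" for N
  proof
    fix m
    have "(\<Sum>n<N. x n * conv (unit_seq n) \<theta> m) = (\<Sum>n\<in>{..<N}\<inter>{..m}. x n * \<theta> (m - n))"
      unfolding sum.inter_restrict[OF finite_lessThan] conv_unit by (auto intro!: sum.cong)
    also have "\<dots> = conv (?t N) \<theta> m"
      unfolding conv_def Int_commute[of "{..<N}"] sum.inter_restrict[OF finite_atMost]
      by (auto intro!: sum.cong)
    finally show "(\<Sum>n<N. x n * conv (unit_seq n) \<theta> m) - conv x \<theta> m
        = conv (\<lambda>n. ?t N n - x n) \<theta> m"
      by (simp add: conv_diff_left)
  qed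
  have t: "?t N \<in> ps_space \<alpha>" for N
    unfolding ps_space_def by (auto intro!: summable_finite[of "{..<N}"] split: if_splits)
  have d: "(\<lambda>n. ?t N n - x n) \<in> ps_space \<alpha>" for N by (rule ps_space_diff[OF t x])
  have k2: "2 * k \<ge> 1" using k by simp
  have "(\<lambda>N. ps_norm \<alpha> (2*k) (\<lambda>n. ?t N n - x n) * ps_norm \<alpha> (2*k) \<theta>)
      \<longlonglongrightarrow> 0 * ps_norm \<alpha> (2*k) \<theta>"
    by (intro tendsto_mult tendsto_const ps_trunc x k2)
  then have lim: "(\<lambda>N. ps_norm \<alpha> (2*k) (\<lambda>n. ?t N n - x n) * ps_norm \<alpha> (2*k) \<theta>) \<longlonglongrightarrow> 0"
    by simp
  show "(\<lambda>N. ps_norm \<alpha> k (\<lambda>m. (\<Sum>n<N. x n * conv (unit_seq n) \<theta> m) - conv x \<theta> m)) \<longlonglongrightarrow> 0"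
    unfolding eq
    by (rule tendsto_sandwich[OF _ _ tendsto_const lim];
        intro always_eventually allI ps_norm_nonneg ps_conv \<alpha> d \<theta> k)
qed

lemma conv_op_unit_sums:
  fixes \<theta> :: "nat \<Rightarrow> 'a::real_normed_field"
  assumes "mono \<alpha>" and "\<theta> \<in> ps_space \<alpha>"
  shows "ps_sums \<alpha> (\<lambda>i m. \<theta> i * unit_seq (n + i) m) (conv_op_unit \<alpha> \<theta> n)"
    and "conv_op_unit \<alpha> \<theta> n = conv (unit_seq n) \<theta>"
proof -
  have "conv (unit_seq i) (unit_seq n) = (unit_seq (n + i) :: nat \<Rightarrow> 'a)" for i
    unfolding fun_eq_iff conv_unit by (auto simp: unit_seq_def)
  then have *: "ps_sums \<alpha> (\<lambda>i m. \<theta> i * unit_seq (n + i) m) (conv (unit_seq n) \<theta>)"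
    using ps_sums_conv[OF assms ps_space_unit, of n]
    by (simp add: conv_commute[of "unit_seq n" \<theta>])
  then show **: "conv_op_unit \<alpha> \<theta> n = conv (unit_seq n) \<theta>"
    unfolding conv_op_unit_def by (rule ps_suminf_eq)
  show "ps_sums \<alpha> (\<lambda>i m. \<theta> i * unit_seq (n + i) m) (conv_op_unit \<alpha> \<theta> n)"
    unfolding ** by (rule *)
qed

lemma conv_op_sums:
  assumes "mono \<alpha>" and "\<theta> \<in> ps_space \<alpha>" and "x \<in> ps_space \<alpha>"
  shows "ps_sums \<alpha> (\<lambda>n m. x n * conv_op_unit \<alpha> \<theta> n m) (conv_op \<alpha> \<theta> x)"
    and "conv_op \<alpha> \<theta> x = conv x \<theta>"
proof -
  have *: "ps_sums \<alpha> (\<lambda>n m. x n * conv_op_unit \<alpha> \<theta> n m) (conv x \<theta>)"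
    using ps_sums_conv[OF assms(1,3,2)] by (simp add: conv_op_unit_sums(2)[OF assms(1,2)])
  then show **: "conv_op \<alpha> \<theta> x = conv x \<theta>"
    unfolding conv_op_def by (rule ps_suminf_eq)
  show "ps_sums \<alpha> (\<lambda>n m. x n * conv_op_unit \<alpha> \<theta> n m) (conv_op \<alpha> \<theta> x)"
    unfolding ** by (rule *)
qed

lemma continuous_linear_operator_conv_op:
  fixes \<theta> :: "nat \<Rightarrow> 'a::real_normed_field"
  assumes \<alpha>: "mono \<alpha>" and \<theta>: "\<theta> \<in> ps_space \<alpha>"
  shows "continuous_linear_operator (ps_space \<alpha>) (ps_norm \<alpha>) (conv_op \<alpha> \<theta>)"
  unfolding continuous_linear_operator_def
proof (intro conjI ballI allI impI)
  note [simp] = conv_op_sums(2)[OF \<alpha> \<theta>]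
  fix x :: "nat \<Rightarrow> 'a" assume x: "x \<in> ps_space \<alpha>"
  show "conv_op \<alpha> \<theta> x \<in> ps_space \<alpha>" using ps_conv(1)[OF \<alpha> x \<theta>] x by simp
  show "conv_op \<alpha> \<theta> (\<lambda>n. x n + y n) = (\<lambda>n. conv_op \<alpha> \<theta> x n + conv_op \<alpha> \<theta> y n)"
    if "y \<in> ps_space \<alpha>" for y
    using x that by (auto simp: ps_space_add conv_def distrib_right sum.distrib)
  show "conv_op \<alpha> \<theta> (\<lambda>n. c * x n) = (\<lambda>n. c * conv_op \<alpha> \<theta> x n)" for c :: 'a
    using x by (auto simp: ps_space_scale conv_def sum_distrib_left mult.assoc)
  fix p :: nat and \<epsilon> :: real assume p: "p \<ge> 1" and \<epsilon>: "\<epsilon> > 0"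
  let ?K = "ps_norm \<alpha> (2*p) \<theta>"
  have K: "?K \<ge> 0" using p by (intro ps_norm_nonneg \<theta>) simp
  show "\<exists>q\<ge>1. \<exists>\<delta>>0. \<forall>y\<in>ps_space \<alpha>. ps_norm \<alpha> q (\<lambda>n. y n - x n) < \<delta> \<longrightarrow>
      ps_norm \<alpha> p (\<lambda>n. conv_op \<alpha> \<theta> y n - conv_op \<alpha> \<theta> x n) < \<epsilon>"
  proof (intro exI conjI ballI impI)
    show "2 * p \<ge> 1" using p by simp
    show "\<epsilon> / (?K + 1) > 0" using K \<epsilon> by simp
    fix y assume y: "y \<in> ps_space \<alpha>"
      and less: "ps_norm \<alpha> (2*p) (\<lambda>n. y n - x n) < \<epsilon> / (?K + 1)"
    have d: "(\<lambda>n. y n - x n) \<in> ps_space \<alpha>" by (rule ps_space_diff[OF y x])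
    have "ps_norm \<alpha> p (\<lambda>n. conv_op \<alpha> \<theta> y n - conv_op \<alpha> \<theta> x n)
        = ps_norm \<alpha> p (conv (\<lambda>n. y n - x n) \<theta>)"
      using x y by (simp add: conv_diff_left)
    also have "\<dots> \<le> ps_norm \<alpha> (2*p) (\<lambda>n. y n - x n) * ?K"
      by (rule ps_conv(2)[OF \<alpha> d \<theta> p])
    also have "\<dots> \<le> \<epsilon> / (?K + 1) * ?K"
      using less K by (intro mult_right_mono) auto
    also have "\<dots> < \<epsilon>" using K \<epsilon> by (simp add: field_simps)
    finally show "ps_norm \<alpha> p (\<lambda>n. conv_op \<alpha> \<theta> y n - conv_op \<alpha> \<theta> x n) < \<epsilon>" .
  qed
qed

lemma conv_power_in_ps_space:
  assumes "mono \<alpha>" and "\<theta> \<in> ps_space \<alpha>"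
  shows "conv_power \<theta> k \<in> ps_space \<alpha>"
  by (induction k) (use assms ps_space_unit ps_conv(1) in auto)

lemma conv_power_1: "conv_power \<theta> 1 = \<theta>"
  by (auto simp: conv_commute[of \<theta>] conv_unit)

end

theory Submission
  imports Defs
begin

text \<open>
  On the space, the operator is multiplication by \<open>\<theta>\<close> in the commutative and associative
  convolution algebra, so its \<open>k\<close>-th iterate is multiplication by the \<open>k\<close>-th convolution power
  of \<open>\<theta>\<close> (\<open>conv_op_funpow\<close>). The convolution powers are thus the orbit of the unit
  sequence at 0, which is the neutral element, and power boundedness evaluated at this single
  vector bounds them in every seminorm. Conversely, convolution is submultiplicative up to a loss
  from \<open>p\<close> to \<open>2 * p\<close> in the seminorms (\<open>ps_conv\<close>), because for \<open>i \<le> m\<close> the monotonicity of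
  \<open>\<alpha>\<close> gives \<open>\<alpha> i + \<alpha> (m - i) \<le> 2 * \<alpha> m\<close>. A bound of the powers in the seminorm \<open>2 * p\<close> hence
  turns into one estimate of all iterates, in the seminorm \<open>p\<close> against the seminorm \<open>2 * p\<close>.
\<close>

text \<open>Through this identity, convolution inherits associativity from formal power series.\<close>

lemma conv_eq_fps_nth: "conv x y = fps_nth (Abs_fps x * Abs_fps y)"
  by (simp add: fun_eq_iff conv_def fps_mult_nth atMost_atLeast0)

lemma conv_assoc: "conv (conv x y) z = conv x (conv y z)"
  by (simp add: conv_eq_fps_nth fps_nth_inverse mult.assoc)

lemma conv_unit_0_left: "conv (unit_seq 0) y = y"
  by (simp add: fun_eq_iff conv_unit)

lemma conv_op_funpow:
  assumes "mono \<alpha>" and "\<theta> \<in> ps_space \<alpha>" and "x \<in> ps_space \<alpha>"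
  shows "(conv_op \<alpha> \<theta> ^^ k) x = conv x (conv_power \<theta> k)"
proof (induction k)
  case 0
  show ?case by (simp add: conv_commute[of x] conv_unit_0_left)
next
  case (Suc k)
  have "conv x (conv_power \<theta> k) \<in> ps_space \<alpha>"
    by (intro ps_conv(1) conv_power_in_ps_space assms)
  then show ?case
    by (simp add: Suc conv_op_sums(2)[OF assms(1,2)] conv_assoc
        conv_commute[of "conv_power \<theta> k" \<theta>])
qed

theorem theorem4p2:
  fixes \<alpha> :: "nat \<Rightarrow> real" and \<theta> :: "nat \<Rightarrow> 'a::{real_normed_field, banach}"
  assumes "\<And>n. 0 \<le> \<alpha> n" and "mono \<alpha>" and "filterlim \<alpha> at_top sequentially"
    and "\<theta> \<in> ps_space \<alpha>"
  shows "power_bounded (ps_space \<alpha>) (ps_norm \<alpha>) (conv_op \<alpha> \<theta>) \<longleftrightarrow>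
    (\<forall>p\<ge>1. bdd_above ((\<lambda>k. ps_norm \<alpha> p (conv_power \<theta> k)) ` {1..}))"
proof
  note funpow = conv_op_funpow[OF assms(2,4)]
  show "\<forall>p\<ge>1. bdd_above ((\<lambda>k. ps_norm \<alpha> p (conv_power \<theta> k)) ` {1..})"
    if bounded: "power_bounded (ps_space \<alpha>) (ps_norm \<alpha>) (conv_op \<alpha> \<theta>)"
  proof (intro allI impI)
    fix p :: nat assume "p \<ge> 1"
    then obtain q C where C: "\<And>k x. k \<ge> 1 \<Longrightarrow> x \<in> ps_space \<alpha> \<Longrightarrow>
        ps_norm \<alpha> p ((conv_op \<alpha> \<theta> ^^ k) x) \<le> C * ps_norm \<alpha> q x"
      using bounded unfolding power_bounded_def by blast
    have "ps_norm \<alpha> p (conv_power \<theta> k) \<le> C * ps_norm \<alpha> q (unit_seq 0 :: nat \<Rightarrow> 'a)"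
      if "k \<ge> 1" for k
      using C[OF that ps_space_unit[of 0]] by (simp add: funpow ps_space_unit conv_unit_0_left)
    then show "bdd_above ((\<lambda>k. ps_norm \<alpha> p (conv_power \<theta> k)) ` {1..})"
      by (intro bdd_aboveI2) auto
  qed
  show "power_bounded (ps_space \<alpha>) (ps_norm \<alpha>) (conv_op \<alpha> \<theta>)"
    if bdd: "\<forall>p\<ge>1. bdd_above ((\<lambda>k. ps_norm \<alpha> p (conv_power \<theta> k)) ` {1..})"
    unfolding power_bounded_def
  proof (intro conjI allI impI)
    show "continuous_linear_operator (ps_space \<alpha>) (ps_norm \<alpha>) (conv_op \<alpha> \<theta>)"
      by (rule continuous_linear_operator_conv_op[OF assms(2,4)])
    fix p :: nat assume p: "p \<ge> 1"
    then have p2: "2 * p \<ge> 1" by simp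
    have "bdd_above ((\<lambda>k. ps_norm \<alpha> (2*p) (conv_power \<theta> k)) ` {1..})"
      by (rule bdd[rule_format, OF p2])
    then obtain M where M: "\<And>k. k \<ge> 1 \<Longrightarrow> ps_norm \<alpha> (2*p) (conv_power \<theta> k) \<le> M"
      unfolding bdd_above_def by auto
    have "ps_norm \<alpha> p ((conv_op \<alpha> \<theta> ^^ k) x) \<le> max 1 M * ps_norm \<alpha> (2*p) x"
      if k: "k \<ge> 1" and x: "x \<in> ps_space \<alpha>" for k x
    proof -
      have "ps_norm \<alpha> p ((conv_op \<alpha> \<theta> ^^ k) x)
          \<le> ps_norm \<alpha> (2*p) x * ps_norm \<alpha> (2*p) (conv_power \<theta> k)"
        unfolding funpow[OF x] by (intro ps_conv(2) conv_power_in_ps_space assms x p)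
      also have "\<dots> \<le> ps_norm \<alpha> (2*p) x * max 1 M"
        using M[OF k] by (intro mult_left_mono ps_norm_nonneg x p2) simp
      finally show ?thesis by (simp add: mult.commute)
    qed
    then show "\<exists>q\<ge>1. \<exists>C\<ge>1. \<forall>k\<ge>1. \<forall>x\<in>ps_space \<alpha>.
        ps_norm \<alpha> p ((conv_op \<alpha> \<theta> ^^ k) x) \<le> C * ps_norm \<alpha> q x"
      by (intro exI[of _ "2*p"] exI[of _ "max 1 M"] conjI allI ballI impI p2 max.cobounded1)
  qed
qed

end
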